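(* Let $f=h+\overline{g}$ be a harmonic function in $\mathbb{D}$ with $h(z)=z+\sum_{n=2}^\infty a_nz^n$ and $g(z)=\sum_{n=1}^\infty b_nz^n$, where $b_1=g'(0)=0$. If $$\sum_{n=2}^\infty n|a_n|+\sum_{n=2}^\infty n|b_n|\le 1,$$ then $f\in\mathcal{C}_H^1\cap\mathcal{S}_H^{*0}$. Moreover, $f$ is fully starlike in $\mathbb{D}$.
   Context: $\mathbb{D}=\{z\in\mathbb{C}:|z|<1\}$. $\mathcal{H}$ is the class of complex-valued harmonic functions $f=h+\overline{g}$ in $\mathbb{D}$ with $h(z)=z+\sum_{n=2}^\infty a_nz^n$ and $g(z)=\sum_{n=1}^\infty b_nz^n$ analytic in $\mathbb{D}$. $\mathcal{S}_H$ is the class of $f\in\mathcal{H}$ that are univalent and sense-preserving (i.e. $|h'|^2-|g'|^2>0$) in $\mathbb{D}$. $\mathcal{C}_H^1=\{f\in\mathcal{S}_H:\ \mathrm{Re}\,f_z(z)>|f_{\overline z}(z)|\text{ for all } z\in\mathbb{D}\}$, where $f_z=h'$ and $f_{\overline z}=\overline{g'}$. $\mathcal{S}_H^{*0}$ is the class of $f\in\mathcal{S}_H$ with $f_{\overline z}(0)=0$ such that $f(\mathbb{D})$ is a starlike domain with respect to the origin. $f$ is fully starlike in $\mathbb{D}$ if for each $0<r<1$ the disk $|z|<r$ is mapped by $f$ onto a domain starlike with respect to the origin. *)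

theory Defs
  imports "HOL-Analysis.Analysis"
begin

abbreviation unit_disk :: "complex set" ("\<DD>") where
  "\<DD> \<equiv> ball 0 1"

text \<open>
  Functions on the disk are total functions of type \<^typ>\<open>complex \<Rightarrow> complex\<close>; all notions below
  depend only on their values on \<open>\<DD>\<close>.
  A power series that converges on all of \<open>\<DD>\<close> converges absolutely there, so unordered
  summation (\<^const>\<open>has_sum\<close>) agrees with the usual convergence of series. Only the
  coefficients \<open>a n\<close> with \<open>n \<ge> 2\<close> and \<open>b n\<close> with \<open>n \<ge> 1\<close> are meaningful.
\<close>

definition harmonic_expansion ::
  "(complex \<Rightarrow> complex) \<Rightarrow> (complex \<Rightarrow> complex) \<Rightarrow> (complex \<Rightarrow> complex) \<Rightarrow>
    (nat \<Rightarrow> complex) \<Rightarrow> (nat \<Rightarrow> complex) \<Rightarrow> bool" where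
  "harmonic_expansion f h g a b \<longleftrightarrow>
     h holomorphic_on \<DD> \<and> g holomorphic_on \<DD> \<and>
     (\<forall>z\<in>\<DD>. f z = h z + cnj (g z)) \<and>
     (\<forall>z\<in>\<DD>. ((\<lambda>n. a n * z ^ n) has_sum (h z - z)) {2..}) \<and>
     (\<forall>z\<in>\<DD>. ((\<lambda>n. b n * z ^ n) has_sum g z) {1..})"

definition class_H :: "(complex \<Rightarrow> complex) set" where
  "class_H = {f. \<exists>h g a b. harmonic_expansion f h g a b}"

text \<open>The pair \<open>(h, g)\<close> is determined by \<open>f\<close> on \<open>\<DD>\<close>, because \<open>g 0 = 0\<close>.\<close>

definition sense_preserving :: "(complex \<Rightarrow> complex) \<Rightarrow> bool" where
  "sense_preserving f \<longleftrightarrow>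
     (\<exists>h g a b. harmonic_expansion f h g a b \<and>
        (\<forall>z\<in>\<DD>. (cmod (deriv h z))\<^sup>2 - (cmod (deriv g z))\<^sup>2 > 0))"

definition class_S_H :: "(complex \<Rightarrow> complex) set" where
  "class_S_H = {f \<in> class_H. inj_on f \<DD> \<and> sense_preserving f}"

text \<open>
  The Wirtinger derivatives \<open>f\<^sub>z = (f\<^sub>x - \<i> f\<^sub>y) / 2\<close> and \<open>(f\<^sub>x + \<i> f\<^sub>y) / 2\<close>, where the partial
  derivatives are the values of the real Frechet derivative at \<open>1\<close> and \<open>\<i>\<close>.
\<close>

definition wirtinger :: "(complex \<Rightarrow> complex) \<Rightarrow> complex \<Rightarrow> complex" where
  "wirtinger f z =
     (frechet_derivative f (at z) 1 - \<i> * frechet_derivative f (at z) \<i>) / 2"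

definition wirtinger_bar :: "(complex \<Rightarrow> complex) \<Rightarrow> complex \<Rightarrow> complex" where
  "wirtinger_bar f z =
     (frechet_derivative f (at z) 1 + \<i> * frechet_derivative f (at z) \<i>) / 2"

lemma wirtinger_harmonic_expansion:
  assumes "harmonic_expansion f h g a b" and z: "z \<in> \<DD>"
  shows "wirtinger f z = deriv h z" and "wirtinger_bar f z = cnj (deriv g z)"
proof -
  have h: "h holomorphic_on \<DD>" and g: "g holomorphic_on \<DD>"
    and f: "\<And>w. w \<in> \<DD> \<Longrightarrow> f w = h w + cnj (g w)"
    using assms(1) by (auto simp: harmonic_expansion_def)
  have "(h has_derivative (*) (deriv h z)) (at z)"
    using holomorphic_derivI[OF h open_ball z] by (simp add: has_field_derivative_def)
  moreover have "(g has_derivative (*) (deriv g z)) (at z)"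
    using holomorphic_derivI[OF g open_ball z] by (simp add: has_field_derivative_def)
  ultimately have
    "((\<lambda>w. h w + cnj (g w)) has_derivative (\<lambda>w. deriv h z * w + cnj (deriv g z * w))) (at z)"
    by (intro has_derivative_add has_derivative_cnj)
  then have "(f has_derivative (\<lambda>w. deriv h z * w + cnj (deriv g z * w))) (at z)"
    by (rule has_derivative_transform_within_open[OF _ open_ball z]) (simp add: f)
  then have "frechet_derivative f (at z) = (\<lambda>w. deriv h z * w + cnj (deriv g z * w))"
    by (rule frechet_derivative_at[symmetric])
  then show "wirtinger f z = deriv h z" and "wirtinger_bar f z = cnj (deriv g z)"
    by (simp_all add: wirtinger_def wirtinger_bar_def algebra_simps)
qed

definition class_C_H1 :: "(complex \<Rightarrow> complex) set" where
  "class_C_H1 = {f \<in> class_S_H. \<forall>z\<in>\<DD>. Re (wirtinger f z) > cmod (wirtinger_bar f z)}"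

text \<open>The library predicate \<^const>\<open>starlike\<close> allows an arbitrary centre; here it is the origin.\<close>

definition starlike_domain :: "complex set \<Rightarrow> bool" where
  "starlike_domain S \<longleftrightarrow>
     open S \<and> connected S \<and> 0 \<in> S \<and> (\<forall>w\<in>S. closed_segment 0 w \<subseteq> S)"

definition class_S_H_star0 :: "(complex \<Rightarrow> complex) set" where
  "class_S_H_star0 = {f \<in> class_S_H. wirtinger_bar f 0 = 0 \<and> starlike_domain (f ` \<DD>)}"

definition fully_starlike :: "(complex \<Rightarrow> complex) \<Rightarrow> bool" where
  "fully_starlike f \<longleftrightarrow> (\<forall>r. 0 < r \<and> r < 1 \<longrightarrow> starlike_domain (f ` ball 0 r))"

end

theory Submission
  imports Defs
begin

text \<open>
  Write \<open>Df z = z h'(z) - cnj (z g'(z))\<close> and \<open>f z = z + H z + cnj (g z)\<close>. The coefficient condition makes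
  \<open>H + cnj g\<close> a strict contraction on smaller disks, so \<open>f\<close> is injective, and comparing coefficients
  gives \<open>\<bar>Df - f\<bar> < \<bar>Df + f\<bar>\<close>, that is \<open>Re (f * cnj Df) > 0\<close>, off the origin. Along a ray
  \<open>t w\<close> the preimage \<open>\<zeta>(t)\<close> satisfies
  \<open>t (\<bar>h'\<bar>\<^sup>2 - \<bar>g'\<bar>\<^sup>2) d/dt \<bar>\<zeta>\<bar>\<^sup>2 = 2 Re (f * cnj Df)\<close>, so its modulus increases with \<open>t\<close>; hence the
  image of every disk about \<open>0\<close> is starlike.
\<close>

section \<open>Termwise differentiation and coefficient bounds for power series\<close>

lemma has_sum_diff:
  fixes u v :: "'i \<Rightarrow> 'a::real_normed_vector"
  assumes "(u has_sum x) I" "(v has_sum y) I"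
  shows "((\<lambda>n. u n - v n) has_sum x - y) I"
  using has_sum_add[OF assms(1), of "\<lambda>n. - v n" "- y"] assms(2) by (simp add: has_sum_uminus)

text \<open>Summability of n |c n| dominates the differentiated series on the disk, so its unordered
  sum exists. Padding with zeros turns it into an ordinary series, whose value termwise
  differentiation identifies.\<close>

lemma has_sum_deriv_power_series:
  fixes c :: "nat \<Rightarrow> complex"
  assumes F: "\<And>z. z \<in> \<DD> \<Longrightarrow> ((\<lambda>n. c n * z ^ n) has_sum F z) {2..}"
    and c: "(\<lambda>n. real n * cmod (c n)) summable_on {2..}"
    and z: "z \<in> \<DD>"
  shows "((\<lambda>n. of_nat n * c n * z ^ (n - 1)) has_sum deriv F z) {2..}"
proof -
  define d where "d n = (if n \<ge> 2 then c n else 0)" for n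
  have sums: "(\<lambda>n. d n * w ^ n) sums F w" if "norm w < 1" for w
  proof -
    have "((\<lambda>n. d n * w ^ n) has_sum F w) UNIV"
      using F[of w] that by (subst has_sum_cong_neutral[where T = "{2..}" and g = "\<lambda>n. c n * w ^ n"])
        (auto simp: d_def)
    then show ?thesis by (rule has_sum_imp_sums)
  qed
  have "(\<lambda>n. norm (of_nat n * c n * z ^ (n - 1))) summable_on {2..}"
  proof (rule summable_on_comparison_test[OF c])
    fix n :: nat
    have "cmod z ^ (n - 1) \<le> 1" using z by (intro power_le_one) auto
    then show "norm (of_nat n * c n * z ^ (n - 1)) \<le> real n * cmod (c n)"
      by (simp add: norm_mult norm_power mult_left_le)
  qed simp
  then have abs: "(\<lambda>n. of_nat n * c n * z ^ (n - 1)) summable_on {2..}"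
    by (rule abs_summable_summable)
  define s where "s = (\<Sum>\<^sub>\<infinity>n\<in>{2..}. of_nat n * c n * z ^ (n - 1))"
  have s: "((\<lambda>n. of_nat n * c n * z ^ (n - 1)) has_sum s) {2..}"
    using abs unfolding s_def by simp
  then have "((\<lambda>n. of_nat n * d n * z ^ (n - 1)) has_sum s) UNIV"
    by (subst has_sum_cong_neutral[where T = "{2..}" and g = "\<lambda>n. of_nat n * c n * z ^ (n - 1)"])
        (auto simp: d_def)
  then have "(\<lambda>n. of_nat n * d n * z ^ (n - 1)) sums s" by (rule has_sum_imp_sums)
  \<comment> \<open>\<open>diffs\<close> shifts the index by one; the term lost at n = 0 carries the
    factor 0.\<close>
  then have "(\<lambda>n. diffs d n * z ^ n) sums s"
    by (simp add: diffs_def sums_Suc_iff[of "\<lambda>n. of_nat n * d n * z ^ (n - 1)", simplified])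
  then have "(\<Sum>n. diffs d n * z ^ n) = s" by (rule sums_unique[symmetric])
  moreover have "((\<lambda>w. \<Sum>n. d n * w ^ n) has_field_derivative (\<Sum>n. diffs d n * z ^ n)) (at z)"
    using z sums by (intro termdiffs_strong'[where K = 1]) (auto simp: sums_iff)
  ultimately have "((\<lambda>w. \<Sum>n. d n * w ^ n) has_field_derivative s) (at z)" by simp
  then have "(F has_field_derivative s) (at z)"
    by (rule has_field_derivative_transform_within_open[OF _ open_ball z])
      (use sums in \<open>auto simp: sums_iff\<close>)
  then show ?thesis using s DERIV_imp_deriv by blast
qed

text \<open>In z F' - F and z F' + F the coefficients c n acquire the factors n - 1 and n + 1. With
  r = |z|, P and Q are the sums of n |c n| r^n and |c n| r^n. Only P is bounded by C: when the
  estimates for two series are combined, the Q terms cancel. The powers of |z| in the bounds come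
  from n \<ge> 2.\<close>

lemma power_series_deriv_bounds:
  fixes c :: "nat \<Rightarrow> complex"
  defines "C \<equiv> \<Sum>\<^sub>\<infinity>n\<in>{2..}. real n * cmod (c n)"
  assumes F: "\<And>z. z \<in> \<DD> \<Longrightarrow> ((\<lambda>n. c n * z ^ n) has_sum F z) {2..}"
    and c: "(\<lambda>n. real n * cmod (c n)) summable_on {2..}"
    and z: "z \<in> \<DD>"
  shows "cmod (deriv F z) \<le> C * cmod z"
    and "\<exists>P Q. P \<le> C * (cmod z)\<^sup>2 \<and> cmod (z * deriv F z - F z) \<le> P - Q \<and>
      cmod (z * deriv F z + F z) \<le> P + Q"
proof -
  define r where "r = cmod z"
  have r: "0 \<le> r" "r < 1" using z by (auto simp: r_def)
  have pow: "r ^ n \<le> r ^ m" if "m \<le> n" for m n using r that by (intro power_decreasing) auto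
  have Csum: "((\<lambda>n. real n * cmod (c n)) has_sum C) {2..}" unfolding C_def using c by simp
  have D: "((\<lambda>n. of_nat n * c n * z ^ (n - 1)) has_sum deriv F z) {2..}"
    by (rule has_sum_deriv_power_series[OF F c z])
  show "cmod (deriv F z) \<le> C * cmod z"
  proof (rule norm_infsum_le[OF D has_sum_cmult_left[OF Csum]])
    fix n :: nat assume "n \<in> {2..}"
    then show "norm (of_nat n * c n * z ^ (n - 1)) \<le> real n * cmod (c n) * cmod z"
      using pow[of 1 "n - 1"] by (auto simp: norm_mult norm_power r_def intro!: mult_left_mono)
  qed
  have zD: "((\<lambda>n. of_nat n * c n * z ^ n) has_sum z * deriv F z) {2..}"
  proof -
    have "((\<lambda>n. z * (of_nat n * c n * z ^ (n - 1))) has_sum z * deriv F z) {2..}"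
      by (rule has_sum_cmult_right[OF D])
    then show ?thesis
      by (rule has_sum_cong[THEN iffD1, rotated]) (auto simp: power_eq_if)
  qed
  have Psum: "(\<lambda>n. real n * cmod (c n) * r ^ n) summable_on {2..}"
  proof (rule summable_on_comparison_test[OF c])
    fix n show "real n * cmod (c n) * r ^ n \<le> real n * cmod (c n)"
      using pow[of 0 n] by (simp add: mult_left_le)
  qed (use r in simp)
  have Qsum: "(\<lambda>n. cmod (c n) * r ^ n) summable_on {2..}"
  proof (rule summable_on_comparison_test[OF Psum])
    fix n :: nat assume n: "n \<in> {2..}"
    have "1 * (cmod (c n) * r ^ n) \<le> real n * (cmod (c n) * r ^ n)"
      using n r by (intro mult_right_mono) auto
    then show "cmod (c n) * r ^ n \<le> real n * cmod (c n) * r ^ n"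
      by (simp add: mult.assoc)
  qed (use r in simp)
  obtain P Q where P: "((\<lambda>n. real n * cmod (c n) * r ^ n) has_sum P) {2..}"
    and Q: "((\<lambda>n. cmod (c n) * r ^ n) has_sum Q) {2..}"
    using Psum Qsum unfolding summable_on_def by blast
  have "P \<le> C * r\<^sup>2"
  proof (rule has_sum_mono[OF P has_sum_cmult_left[OF Csum]])
    fix n :: nat assume "n \<in> {2..}"
    then show "real n * cmod (c n) * r ^ n \<le> real n * cmod (c n) * r\<^sup>2"
      using pow[of 2 n] by (auto intro!: mult_left_mono)
  qed
  moreover have "cmod (z * deriv F z - F z) \<le> P - Q"
  proof (rule norm_infsum_le[OF has_sum_diff[OF zD F[OF z]] has_sum_diff[OF P Q]])
    fix n :: nat assume n: "n \<in> {2..}"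
    have "of_nat n * c n * z ^ n - c n * z ^ n = of_real (real n - 1) * (c n * z ^ n)"
      by (simp add: algebra_simps)
    then show "norm (of_nat n * c n * z ^ n - c n * z ^ n)
        \<le> real n * cmod (c n) * r ^ n - cmod (c n) * r ^ n"
      using n by (simp only: norm_mult norm_power norm_of_real) (simp add: r_def algebra_simps)
  qed
  moreover have "cmod (z * deriv F z + F z) \<le> P + Q"
  proof (rule norm_infsum_le[OF has_sum_add[OF zD F[OF z]] has_sum_add[OF P Q]])
    fix n :: nat assume n: "n \<in> {2..}"
    have "of_nat n * c n * z ^ n + c n * z ^ n = of_real (real n + 1) * (c n * z ^ n)"
      by (simp add: algebra_simps)
    then show "norm (of_nat n * c n * z ^ n + c n * z ^ n)
        \<le> real n * cmod (c n) * r ^ n + cmod (c n) * r ^ n"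
      using n by (simp only: norm_mult norm_power norm_of_real) (simp add: r_def algebra_simps)
  qed
  ultimately show "\<exists>P Q. P \<le> C * (cmod z)\<^sup>2 \<and> cmod (z * deriv F z - F z) \<le> P - Q \<and>
      cmod (z * deriv F z + F z) \<le> P + Q"
    unfolding r_def by blast
qed

section \<open>A criterion for starlike images of disks\<close>

text \<open>Polarization: |u + v|^2 - |u - v|^2 = 4 Re (u * cnj v).\<close>

lemma Re_mult_cnj_pos:
  assumes "cmod (u - v) < cmod (u + v)"
  shows "0 < Re (u * cnj v)"
proof -
  have "(cmod (u - v))\<^sup>2 < (cmod (u + v))\<^sup>2"
    using assms by (intro power_strict_mono) auto
  then show ?thesis unfolding cmod_power2 by (simp add: power2_eq_square algebra_simps)
qed

text \<open>
  The set of \<open>t\<close> with \<open>t w \<in> f ` cball 0 \<bar>z\<^sub>0\<bar>\<close> is closed, and it is open to the left because the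
  modulus of the preimage of \<open>t w\<close> increases with \<open>t\<close>.
\<close>

lemma starlike_domain_image_ball:
  fixes f :: "complex \<Rightarrow> complex"
  assumes f0: "f 0 = 0" and inj: "inj_on f \<DD>"
    and der: "\<And>z. z \<in> \<DD> \<Longrightarrow> (f has_derivative (\<lambda>w. p z * w + cnj (q z * w))) (at z)"
    and J: "\<And>z. z \<in> \<DD> \<Longrightarrow> cmod (q z) < cmod (p z)"
    and pos: "\<And>z. z \<in> \<DD> \<Longrightarrow> z \<noteq> 0 \<Longrightarrow> 0 < Re (f z * cnj (z * p z - cnj (z * q z)))"
    and r: "0 < r" "r \<le> 1"
  shows "starlike_domain (f ` ball 0 r)"
proof -
  have sub: "ball 0 r \<subseteq> \<DD>" using r by (intro subset_ball)
  have cont: "continuous_on \<DD> f"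
    by (intro differentiable_imp_continuous_on differentiable_at_imp_differentiable_on)
      (use der in \<open>auto simp: differentiable_def\<close>)
  define F where "F = inv_into \<DD> f"
  have Ff: "F (f z) = z" if "z \<in> \<DD>" for z
    unfolding F_def by (rule inv_into_f_f[OF inj that])
  have opn: "open (f ` \<DD>)"
    by (rule invariance_of_domain[OF cont open_ball inj])
  \<comment> \<open>The radius \<open>\<rho>\<close> is separate from |z| because it stays fixed at
    the modulus of the starting point while z runs through preimages of points further down the
    ray.\<close>
  have left: "\<exists>e>0. \<forall>s. 0 < s \<and> s < e \<longrightarrow> (t - s) *\<^sub>R w \<in> f ` cball 0 \<rho>"
    if z: "z \<in> \<DD>" "cmod z \<le> \<rho>" "f z = t *\<^sub>R w" and t: "0 < t" and w: "w \<noteq> 0" for z t w \<rho>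
  proof -
    define j where "j = (cmod (p z))\<^sup>2 - (cmod (q z))\<^sup>2"
    have j: "j > 0"
      using power_strict_mono[OF J[OF z(1)], of 2] by (simp add: j_def)
    \<comment> \<open>Solving p u + cnj (q u) = v together with its conjugate for u, by Cramer's
      rule; j is the determinant, the Jacobian of f at z.\<close>
    define G where "G v = (cnj (p z) * v - cnj (q z) * cnj v) / of_real j" for v
    have j': "p z * cnj (p z) - q z * cnj (q z) = of_real j"
      unfolding j_def of_real_diff complex_norm_square ..
    have "p z * G v + cnj (q z * G v) = v" for v
    proof -
      have "p z * G v + cnj (q z * G v) = v * (p z * cnj (p z) - q z * cnj (q z)) / of_real j"
        unfolding G_def by (simp add: algebra_simps flip: add_divide_distrib diff_divide_distrib)
      then show ?thesis using j by (simp only: j') simp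
    qed
    then have inv: "(\<lambda>w. p z * w + cnj (q z * w)) \<circ> G = id" by auto
    have "(F has_derivative G) (at (f z))"
      by (rule has_derivative_inverse_strong[OF open_ball z(1) cont _ der[OF z(1)] inv])
        (use Ff in auto)
    then have "(F has_derivative G) (at (t *\<^sub>R w))" using z by simp
    moreover have "((\<lambda>t. t *\<^sub>R w) has_derivative (\<lambda>s. s *\<^sub>R w)) (at t)"
      by (auto intro!: derivative_eq_intros)
    ultimately have "((\<lambda>t. F (t *\<^sub>R w)) has_derivative (\<lambda>s. G (s *\<^sub>R w))) (at t)"
      using has_derivative_compose by fastforce
    then have "((\<lambda>t. F (t *\<^sub>R w) \<bullet> F (t *\<^sub>R w)) has_derivative
        (\<lambda>s. F (t *\<^sub>R w) \<bullet> G (s *\<^sub>R w) + G (s *\<^sub>R w) \<bullet> F (t *\<^sub>R w))) (at t)"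
      by (intro has_derivative_inner)
    moreover have "(\<lambda>s. F (t *\<^sub>R w) \<bullet> G (s *\<^sub>R w) + G (s *\<^sub>R w) \<bullet> F (t *\<^sub>R w)) = (*) (2 * (z \<bullet> G w))"
    proof -
      have "F (t *\<^sub>R w) = z" using Ff[OF z(1)] z(3) by simp
      moreover have "G (s *\<^sub>R w) = s *\<^sub>R G w" for s
        by (simp add: G_def scaleR_conv_of_real algebra_simps)
      ultimately show ?thesis by (auto simp: inner_commute)
    qed
    ultimately have deriv: "((\<lambda>t. F (t *\<^sub>R w) \<bullet> F (t *\<^sub>R w)) has_real_derivative 2 * (z \<bullet> G w)) (at t)"
      by (simp add: has_field_derivative_def)
    have "z \<noteq> 0" using z(3) f0 t w by auto
    then have "0 < Re (f z * cnj (z * p z - cnj (z * q z)))" by (rule pos[OF z(1)])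
    \<comment> \<open>Insert f z = t w; the q-terms on both sides are conjugate, hence have equal
      real parts.\<close>
    also have "\<dots> = t * j * (z \<bullet> G w)"
      using j unfolding z(3) G_def
      by (simp add: inner_complex_def scaleR_conv_of_real Re_divide_of_real Im_divide_of_real
          field_simps)
    finally have "0 < 2 * (z \<bullet> G w)"
      using zero_less_mult_pos[of "t * j" "z \<bullet> G w"] t j by simp
    then obtain e1 where e1: "e1 > 0"
        "\<And>s. 0 < s \<Longrightarrow> s < e1 \<Longrightarrow> F ((t - s) *\<^sub>R w) \<bullet> F ((t - s) *\<^sub>R w) < F (t *\<^sub>R w) \<bullet> F (t *\<^sub>R w)"
      using DERIV_pos_inc_left[OF deriv] by auto
    \<comment> \<open>The decrease of |F| says something about preimages only at points of the
      image, since \<open>inv_into\<close> is unspecified elsewhere. Openness of the image keeps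
      nearby points of the ray inside it.\<close>
    have "open ((\<lambda>t. t *\<^sub>R w) -` (f ` \<DD>))"
      by (intro open_vimage opn continuous_intros)
    moreover have "t \<in> (\<lambda>t. t *\<^sub>R w) -` (f ` \<DD>)"
      using imageI[OF z(1), of f] by (simp only: z(3) vimage_eq)
    ultimately obtain e2 where e2: "e2 > 0" "ball t e2 \<subseteq> (\<lambda>t. t *\<^sub>R w) -` (f ` \<DD>)"
      by (meson openE)
    show ?thesis
    proof (intro exI[of _ "min e1 e2"] conjI allI impI)
      fix s assume s: "0 < s \<and> s < min e1 e2"
      then have "t - s \<in> ball t e2" by (auto simp: dist_real_def)
      then obtain y where y: "y \<in> \<DD>" "(t - s) *\<^sub>R w = f y" using e2(2) by blast
      have "F (t *\<^sub>R w) = z" using Ff[OF z(1)] z(3) by simp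
      then have "(cmod y)\<^sup>2 < (cmod z)\<^sup>2"
        using e1(2)[of s] s y Ff[of y] by (simp add: power2_norm_eq_inner)
      then have "cmod y < cmod z" by (rule power_less_imp_less_base) simp
      then show "(t - s) *\<^sub>R w \<in> f ` cball 0 \<rho>" using y z by auto
    qed (use e1 e2 in auto)
  qed
  \<comment> \<open>The closed disk of radius |z| makes the image compact, and it lies in every open
    disk about 0 containing z.\<close>
  have seg: "t *\<^sub>R f z \<in> f ` cball 0 (cmod z)" if z: "z \<in> \<DD>" and t: "0 \<le> t" "t \<le> 1" for z t
  proof (cases "f z = 0 \<or> t = 0")
    case True
    then show ?thesis using f0 by (auto simp: image_iff intro: bexI[of _ 0])
  next
    case False
    then have w: "f z \<noteq> 0" and t0: "0 < t" using t by auto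
    have cb: "cball 0 (cmod z) \<subseteq> \<DD>" using z by auto
    \<comment> \<open>U contains 1 and is closed. It is cut off at t > 0, since \<open>left\<close>
      applies only to positive parameters; if its infimum exceeded t, \<open>left\<close> would
      produce a smaller element.\<close>
    define U where "U = {s \<in> {t..1}. s *\<^sub>R f z \<in> f ` cball 0 (cmod z)}"
    have "compact (f ` cball 0 (cmod z))"
      by (intro compact_continuous_image continuous_on_subset[OF cont cb] compact_cball)
    then have "closed ({t..1} \<inter> (\<lambda>s. s *\<^sub>R f z) -` (f ` cball 0 (cmod z)))"
      by (intro closed_Int closed_vimage compact_imp_closed continuous_intros) auto
    then have clo: "closed U" unfolding U_def by (simp add: vimage_def Int_def)
    have ne: "U \<noteq> {}" using t by (auto simp: U_def intro!: exI[of _ 1])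
    have bdd: "bdd_below U" by (auto simp: U_def bdd_below_def)
    define m where "m = Inf U"
    have m: "m \<in> U" unfolding m_def by (rule closed_contains_Inf[OF ne bdd clo])
    have "m = t"
    proof (rule ccontr)
      assume "m \<noteq> t"
      with m have tm: "t < m" "m \<le> 1" by (auto simp: U_def)
      from m obtain y where y: "cmod y \<le> cmod z" "f y = m *\<^sub>R f z" by (auto simp: U_def)
      then obtain e where e: "e > 0"
          "\<And>s. 0 < s \<and> s < e \<Longrightarrow> (m - s) *\<^sub>R f z \<in> f ` cball 0 (cmod z)"
        using left[of y "cmod z" m "f z"] w t0 tm z by auto
      \<comment> \<open>Halving e gives s < e strictly; the bound m - t keeps m - s in
        \<open>{t..1}\<close>.\<close>
      define s where "s = min (e / 2) (m - t)"
      have s: "0 < s" "s < e" "s \<le> m - t" using e tm by (auto simp: s_def)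
      then have "m - s \<in> U" using e(2)[of s] tm by (auto simp: U_def)
      then have "m \<le> m - s" unfolding m_def by (rule cInf_lower[OF _ bdd])
      then show False using s by simp
    qed
    then show ?thesis using m by (auto simp: U_def)
  qed
  show ?thesis
    unfolding starlike_domain_def
  proof (intro conjI ballI)
    show "open (f ` ball 0 r)"
      by (rule invariance_of_domain[OF continuous_on_subset[OF cont sub] open_ball
            inj_on_subset[OF inj sub]])
    show "connected (f ` ball 0 r)"
      by (rule connected_continuous_image[OF continuous_on_subset[OF cont sub]]) simp
    show "0 \<in> f ` ball 0 r" using f0 r by (auto simp: image_iff intro!: bexI[of _ 0])
  next
    fix w assume "w \<in> f ` ball 0 r"
    then obtain z where z: "z \<in> ball 0 r" "w = f z" by blast
    have "cball 0 (cmod z) \<subseteq> ball 0 r" using z by auto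
    then have "t *\<^sub>R f z \<in> f ` ball 0 r" if "0 \<le> t" "t \<le> 1" for t
      using seg[of z t] z sub that by blast
    then show "closed_segment 0 w \<subseteq> f ` ball 0 r"
      using z by (auto simp: closed_segment_def)
  qed
qed

section \<open>The criterion applied to harmonic functions with small coefficients\<close>

theorem lemma2:
  fixes f h g :: "complex \<Rightarrow> complex" and a b :: "nat \<Rightarrow> complex"
  assumes "harmonic_expansion f h g a b"
    and "b 1 = 0"
    and "(\<lambda>n. real n * cmod (a n)) summable_on {2..}"
    and "(\<lambda>n. real n * cmod (b n)) summable_on {2..}"
    and "(\<Sum>\<^sub>\<infinity>n\<in>{2..}. real n * cmod (a n)) + (\<Sum>\<^sub>\<infinity>n\<in>{2..}. real n * cmod (b n)) \<le> 1"
  shows "f \<in> class_C_H1 \<inter> class_S_H_star0 \<and> fully_starlike f"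
proof -
  define A where "A = (\<Sum>\<^sub>\<infinity>n\<in>{2..}. real n * cmod (a n))"
  define B where "B = (\<Sum>\<^sub>\<infinity>n\<in>{2..}. real n * cmod (b n))"
  define H where "H z = h z - z" for z
  have AB: "0 \<le> A" "0 \<le> B" "A + B \<le> 1"
    using assms(5) unfolding A_def B_def by (simp_all add: infsum_nonneg)
  have hol: "h holomorphic_on \<DD>" "g holomorphic_on \<DD>"
    and f: "\<And>z. z \<in> \<DD> \<Longrightarrow> f z = h z + cnj (g z)"
    and Hs: "\<And>z. z \<in> \<DD> \<Longrightarrow> ((\<lambda>n. a n * z ^ n) has_sum H z) {2..}"
    and g1: "\<And>z. z \<in> \<DD> \<Longrightarrow> ((\<lambda>n. b n * z ^ n) has_sum g z) {1..}"
    using assms(1) by (auto simp: harmonic_expansion_def H_def)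
  \<comment> \<open>Since \<open>b 1 = 0\<close>, the series of g also starts at 2, so H and g fall
    under the same bounds.\<close>
  have gs: "((\<lambda>n. b n * z ^ n) has_sum g z) {2..}" if "z \<in> \<DD>" for z
  proof -
    have "b n = 0" if "n \<in> {1..} - {2..}" for n
    proof -
      have "n = 1" using that by auto
      then show ?thesis using assms(2) by simp
    qed
    then have "((\<lambda>n. b n * z ^ n) has_sum g z) {1..} \<longleftrightarrow> ((\<lambda>n. b n * z ^ n) has_sum g z) {2..}"
      by (intro has_sum_cong_neutral) auto
    then show ?thesis using g1[OF that] by simp
  qed
  have Hb: "cmod (deriv H z) \<le> A * cmod z"
    "\<exists>P Q. P \<le> A * (cmod z)\<^sup>2 \<and> cmod (z * deriv H z - H z) \<le> P - Q \<and>
      cmod (z * deriv H z + H z) \<le> P + Q" if "z \<in> \<DD>" for z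
    using power_series_deriv_bounds[OF Hs assms(3) that] unfolding A_def by blast+
  have gb: "cmod (deriv g z) \<le> B * cmod z"
    "\<exists>P Q. P \<le> B * (cmod z)\<^sup>2 \<and> cmod (z * deriv g z - g z) \<le> P - Q \<and>
      cmod (z * deriv g z + g z) \<le> P + Q" if "z \<in> \<DD>" for z
    using power_series_deriv_bounds[OF gs assms(4) that] unfolding B_def by blast+
  have hd: "(h has_field_derivative deriv h z) (at z)" and gd: "(g has_field_derivative deriv g z) (at z)"
    if "z \<in> \<DD>" for z
    using hol holomorphic_derivI[OF _ open_ball that] by auto
  have Hd: "(H has_field_derivative deriv h z - 1) (at z)" if "z \<in> \<DD>" for z
    unfolding H_def by (auto intro!: derivative_eq_intros hd[OF that])
  have H': "deriv H z = deriv h z - 1" if "z \<in> \<DD>" for z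
    by (rule DERIV_imp_deriv[OF Hd[OF that]])
  have fH: "f z = z + H z + cnj (g z)" if "z \<in> \<DD>" for z
    using f[OF that] by (simp add: H_def)
  have der: "(f has_derivative (\<lambda>w. deriv h z * w + cnj (deriv g z * w))) (at z)" if "z \<in> \<DD>" for z
  proof -
    have "((\<lambda>z. h z + cnj (g z)) has_derivative (\<lambda>w. deriv h z * w + cnj (deriv g z * w))) (at z)"
      using hd[OF that] gd[OF that] unfolding has_field_derivative_def
      by (intro has_derivative_add has_derivative_cnj)
    then show ?thesis
      by (rule has_derivative_transform_within_open[OF _ open_ball that]) (simp add: f)
  qed
  have sum_lt: "A * x + B * x \<le> x" if "0 \<le> x" for x
    using mult_right_mono[OF AB(3) that] by (simp add: algebra_simps)
  \<comment> \<open>The left side is at most (A + B) |z| \<le> |z| < 1. This yields both the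
    condition on Re h' and a positive Jacobian.\<close>
  have close: "cmod (deriv h z - 1) + cmod (deriv g z) < 1" if "z \<in> \<DD>" for z
    using Hb(1)[OF that] gb(1)[OF that] sum_lt[of "cmod z"] that by (simp add: H'[OF that])
  have Re: "cmod (deriv g z) < Re (deriv h z)" if "z \<in> \<DD>" for z
    using close[OF that] abs_Re_le_cmod[of "deriv h z - 1"] by simp
  have J: "cmod (deriv g z) < cmod (deriv h z)" if "z \<in> \<DD>" for z
    using Re[OF that] complex_Re_le_cmod by (rule less_le_trans)
  have inj: "inj_on f \<DD>"
  proof (rule inj_onI)
    fix x y assume xy: "x \<in> \<DD>" "y \<in> \<DD>" "f x = f y"
    \<comment> \<open>On all of the disk the bounds give only the Lipschitz constant A + B \<le> 1.
      On the closed disk of radius r, which contains x and y, it drops to at most r < 1.\<close>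
    define r where "r = max (cmod x) (cmod y)"
    have r: "r < 1" "0 \<le> r" "x \<in> cball 0 r" "y \<in> cball 0 r" "cball 0 r \<subseteq> \<DD>"
      using xy by (auto simp: r_def le_max_iff_disj)
    have "cmod (H x - H y) \<le> A * r * cmod (x - y)"
    proof (rule field_differentiable_bound[OF convex_cball _ _ r(3,4)])
      fix z :: complex assume z: "z \<in> cball 0 r"
      then show "(H has_field_derivative deriv H z) (at z within cball 0 r)"
        using Hd[of z] H'[of z] r by (auto intro: has_field_derivative_at_within)
      show "cmod (deriv H z) \<le> A * r"
        using Hb(1)[of z] z r mult_left_mono[OF _ AB(1), of "cmod z" r] by force
    qed
    moreover have "cmod (g x - g y) \<le> B * r * cmod (x - y)"
    proof (rule field_differentiable_bound[OF convex_cball _ _ r(3,4)])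
      fix z :: complex assume z: "z \<in> cball 0 r"
      then show "(g has_field_derivative deriv g z) (at z within cball 0 r)"
        using gd[of z] r by (auto intro: has_field_derivative_at_within)
      show "cmod (deriv g z) \<le> B * r"
        using gb(1)[of z] z r mult_left_mono[OF _ AB(2), of "cmod z" r] by force
    qed
    moreover have "x - y = - (H x - H y) - cnj (g x - g y)"
      using xy by (simp add: fH algebra_simps)
    then have "cmod (x - y) \<le> cmod (H x - H y) + cmod (g x - g y)"
      by (metis complex_mod_cnj norm_minus_cancel norm_triangle_ineq4)
    ultimately have "cmod (x - y) \<le> (A * r + B * r) * cmod (x - y)"
      by (simp add: algebra_simps)
    also have "\<dots> \<le> r * cmod (x - y)"
      by (intro mult_right_mono sum_lt r norm_ge_zero)
    finally have "(1 - r) * cmod (x - y) \<le> 0" by (simp add: algebra_simps)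
    then show "x = y" using r by (simp add: mult_le_0_iff)
  qed
  have pos: "0 < Re (f z * cnj (z * deriv h z - cnj (z * deriv g z)))" if z: "z \<in> \<DD>" "z \<noteq> 0" for z
  proof (rule Re_mult_cnj_pos)
    let ?v = "z * deriv h z - cnj (z * deriv g z)"
    obtain P Q where P: "P \<le> A * (cmod z)\<^sup>2" "cmod (z * deriv H z - H z) \<le> P - Q"
      "cmod (z * deriv H z + H z) \<le> P + Q" using Hb(2)[OF z(1)] by blast
    obtain R S where R: "R \<le> B * (cmod z)\<^sup>2" "cmod (z * deriv g z - g z) \<le> R - S"
      "cmod (z * deriv g z + g z) \<le> R + S" using gb(2)[OF z(1)] by blast
    \<comment> \<open>The linear term z cancels in f - Df and doubles in f + Df. As g enters Df with
      the opposite sign, its factors n - 1 and n + 1 are swapped relative to H.\<close>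
    have eq1: "f z - ?v = - (z * deriv H z - H z) + cnj (z * deriv g z + g z)"
      and eq2: "2 * z = (f z + ?v) - (z * deriv H z + H z) + cnj (z * deriv g z - g z)"
      using z by (simp_all add: fH H' algebra_simps)
    have "cmod (f z - ?v) \<le> cmod (z * deriv H z - H z) + cmod (z * deriv g z + g z)"
      unfolding eq1 by (metis complex_mod_cnj norm_minus_cancel norm_triangle_ineq)
    moreover have "cmod (2 * z) \<le> cmod (f z + ?v) + cmod (z * deriv H z + H z) + cmod (z * deriv g z - g z)"
      by (subst eq2) (metis (no_types) add_right_mono complex_mod_cnj norm_triangle_ineq
          norm_triangle_ineq4 order_trans)
    \<comment> \<open>Q and S cancel between the two estimates, leaving 2 (P + R) < 2 |z| to show.
      Here P + R \<le> |z|^2, and strictness comes from 0 < |z| < 1.\<close>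
    moreover have "(cmod z)\<^sup>2 < cmod z"
      using z by (simp add: power2_eq_square)
    ultimately show "cmod (f z - ?v) < cmod (f z + ?v)"
      using P R sum_lt[of "(cmod z)\<^sup>2"] by (simp add: norm_mult)
  qed
  have "f 0 = 0"
  proof -
    have "((\<lambda>n. c n * 0 ^ n) has_sum 0) {2..}" for c :: "nat \<Rightarrow> complex"
      by (rule has_sum_0) auto
    then have "H 0 = 0" "g 0 = 0" using Hs[of 0] gs[of 0] by (auto intro: has_sum_unique)
    then show ?thesis by (simp add: fH)
  qed
  \<comment> \<open>r = 1 covers the image of the whole disk, r < 1 full starlikeness.\<close>
  then have star: "starlike_domain (f ` ball 0 r)" if "0 < r" "r \<le> 1" for r
    using that by (intro starlike_domain_image_ball[OF _ inj der J pos]) auto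
  have "f \<in> class_H" using assms(1) by (auto simp: class_H_def)
  moreover have "sense_preserving f"
    unfolding sense_preserving_def
    using assms(1) J by (intro exI conjI ballI) (auto intro!: power_strict_mono)
  ultimately have S: "f \<in> class_S_H" using inj by (simp add: class_S_H_def)
  \<comment> \<open>The bound |g'(z)| \<le> B |z| at z = 0 forces g'(0) = 0.\<close>
  have "wirtinger_bar f 0 = 0"
    using wirtinger_harmonic_expansion(2)[OF assms(1), of 0] gb(1)[of 0] by simp
  then show ?thesis
    using S Re star
    by (auto simp: class_C_H1_def class_S_H_star0_def fully_starlike_def
        wirtinger_harmonic_expansion[OF assms(1)])
qed

end
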